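(* Let $R$ be a finite commutative Frobenius ring with a fixed generating character $\varepsilon:(R,+)\to\mathbb{C}^\times$, put $\mu_R=\varepsilon(R)$, let $n\ge 1$, and let $\beta:R^n\times R^n\to R$ be a nondegenerate bilinear pairing. Let $H_R$ be the associated Frobenius Heisenberg group, with centre $Z(H_R)=\{(0,0,\lambda):\lambda\in\mu_R\}\cong\mu_R$, and let $\omega:\mu_R\to\mathbb{C}^\times$, $\omega(\lambda)=\lambda$, be the identity character of the centre. Then: (1) There exists a centrally faithful representation $\rho$ of $H_R$ which is Frobenius indecomposable with respect to the central character $\omega$ and whose restriction to the centre $Z(H_R)\cong\mu_R$ is $\omega$. (2) Any two centrally faithful representations of $H_R$ with central character $\omega$ which are Frobenius indecomposable with respect to the central character $\omega$ are isomorphic. (3) Up to isomorphism, this unique representation is the Schrödinger representation $\pi$ of $H_R$ on $S_R=\mathrm{Fun}(R^n,\mathbb{C})$.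
   Context: Rings are associative with $1\neq 0$. A character $\varepsilon:(R,+)\to\mathbb{C}^\times$ of a finite ring $R$ is generating if its kernel contains no nonzero one-sided ideal of $R$; a finite ring is Frobenius iff it has a generating character. $\mathrm{Fun}(R^n,\mathbb{C})$ is the space of all functions $R^n\to\mathbb{C}$. Nondegeneracy of $\beta$ means: for every nonzero $x\in R^n$ there is $y\in R^n$ with $\varepsilon(\beta(y,x))\ne1$, and for every nonzero $y\in R^n$ there is $x\in R^n$ with $\varepsilon(\beta(y,x))\neq 1$. Frobenius Heisenberg group: the set $H_R=R^n\times R^n\times\mu_R$ with multiplication $(x,y,\lambda)(x',y',\mu)=(x+x',\,y+y',\,\lambda\mu\,\varepsilon(\beta(y',x)))$. Schrödinger representation: $\pi:H_R\to\mathrm{GL}(S_R)$, $\pi(x,y,\lambda)=\lambda M_yT_x$, where $S_R=\mathrm{Fun}(R^n,\mathbb{C})$, $(T_xf)(u)=f(u+x)$, $(M_yf)(u)=\varepsilon(\beta(y,u))f(u)$. Representations are on nonzero complex vector spaces. A representation $\rho:H_R\to\mathrm{GL}(V)$ has central character $\chi:Z(H_R)\to\mu_R$ if $\rho(z)=\chi(z)\,\mathrm{id}_V$ for all $z\in Z(H_R)$. It is centrally faithful if it has a central character and this character is nontrivial. A centrally faithful representation is Frobenius indecomposable if it has no proper nonzero centrally faithful subrepresentation; "with respect to the central character $\omega$" means that its central character is $\omega$. *)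

theory Defs
  imports
    Complex_Main
    "HOL-Library.Function_Algebras"
    "HOL-Analysis.Finite_Cartesian_Product"
    "HOL-Algebra.Bij"
begin

section \<open>Generating characters of finite rings\<close>

definition left_ideal :: "'r::ring_1 set \<Rightarrow> bool" where
  "left_ideal I \<longleftrightarrow> 0 \<in> I \<and> (\<forall>a\<in>I. \<forall>b\<in>I. a + b \<in> I) \<and> (\<forall>r. \<forall>a\<in>I. r * a \<in> I)"

definition right_ideal :: "'r::ring_1 set \<Rightarrow> bool" where
  "right_ideal I \<longleftrightarrow> 0 \<in> I \<and> (\<forall>a\<in>I. \<forall>b\<in>I. a + b \<in> I) \<and> (\<forall>r. \<forall>a\<in>I. a * r \<in> I)"

definition additive_character :: "('r::ring_1 \<Rightarrow> complex) \<Rightarrow> bool" where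
  "additive_character \<epsilon> \<longleftrightarrow> (\<forall>a. \<epsilon> a \<noteq> 0) \<and> (\<forall>a b. \<epsilon> (a + b) = \<epsilon> a * \<epsilon> b)"

text \<open>A finite ring is Frobenius iff it has a generating character, so for a finite ring the
  existence of \<open>\<epsilon>\<close> with the following property is the Frobenius condition.\<close>

definition generating_character :: "('r::{ring_1,finite} \<Rightarrow> complex) \<Rightarrow> bool" where
  "generating_character \<epsilon> \<longleftrightarrow> additive_character \<epsilon> \<and>
     (\<forall>I. (left_ideal I \<or> right_ideal I) \<and> I \<subseteq> {a. \<epsilon> a = 1} \<longrightarrow> I = {0})"


section \<open>Pairings on \<open>R\<^sup>n\<close>\<close>

definition bilinear_pairing :: "('r::comm_ring_1 ^ 'n \<Rightarrow> 'r ^ 'n \<Rightarrow> 'r) \<Rightarrow> bool" where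
  "bilinear_pairing \<beta> \<longleftrightarrow>
     (\<forall>y. module_hom (*s) (*) (\<lambda>x. \<beta> y x)) \<and> (\<forall>x. module_hom (*s) (*) (\<lambda>y. \<beta> y x))"

definition nondegenerate_pairing ::
  "('r::comm_ring_1 \<Rightarrow> complex) \<Rightarrow> ('r ^ 'n \<Rightarrow> 'r ^ 'n \<Rightarrow> 'r) \<Rightarrow> bool" where
  "nondegenerate_pairing \<epsilon> \<beta> \<longleftrightarrow>
     (\<forall>x. x \<noteq> 0 \<longrightarrow> (\<exists>y. \<epsilon> (\<beta> y x) \<noteq> 1)) \<and> (\<forall>y. y \<noteq> 0 \<longrightarrow> (\<exists>x. \<epsilon> (\<beta> y x) \<noteq> 1))"


section \<open>Complex representations on linear subspaces\<close>

text \<open>A complex vector space is a linear subspace \<open>V\<close> of a type \<open>'v\<close> carrying a scalar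
  multiplication \<open>s\<close>; this way subrepresentations are representations of the same kind.
  No finiteness of the dimension is assumed.\<close>

definition linear_between ::
  "(complex \<Rightarrow> 'v::ab_group_add \<Rightarrow> 'v) \<Rightarrow> 'v set \<Rightarrow>
   (complex \<Rightarrow> 'w::ab_group_add \<Rightarrow> 'w) \<Rightarrow> 'w set \<Rightarrow> ('v \<Rightarrow> 'w) \<Rightarrow> bool" where
  "linear_between s V t W f \<longleftrightarrow> f \<in> V \<rightarrow> W \<and>
     (\<forall>u\<in>V. \<forall>v\<in>V. f (u + v) = f u + f v) \<and> (\<forall>c. \<forall>v\<in>V. f (s c v) = t c (f v))"

definition GL :: "(complex \<Rightarrow> 'v::ab_group_add \<Rightarrow> 'v) \<Rightarrow> 'v set \<Rightarrow> ('v \<Rightarrow> 'v) monoid" where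
  "GL s V = BijGroup V \<lparr>carrier := {f \<in> Bij V. linear_between s V s V f}\<rparr>"

definition group_rep ::
  "('g, 'm) monoid_scheme \<Rightarrow> (complex \<Rightarrow> 'v::ab_group_add \<Rightarrow> 'v) \<Rightarrow> 'v set \<Rightarrow>
   ('g \<Rightarrow> 'v \<Rightarrow> 'v) \<Rightarrow> bool" where
  "group_rep G s V \<rho> \<longleftrightarrow>
     vector_space s \<and> module.subspace s V \<and> V \<noteq> {0} \<and> \<rho> \<in> hom G (GL s V)"

definition subrep ::
  "('g, 'm) monoid_scheme \<Rightarrow> (complex \<Rightarrow> 'v::ab_group_add \<Rightarrow> 'v) \<Rightarrow> 'v set \<Rightarrow>
   ('g \<Rightarrow> 'v \<Rightarrow> 'v) \<Rightarrow> 'v set \<Rightarrow> bool" where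
  "subrep G s V \<rho> W \<longleftrightarrow>
     module.subspace s W \<and> W \<subseteq> V \<and> (\<forall>g\<in>carrier G. \<rho> g ` W \<subseteq> W)"

definition rep_isomorphic ::
  "('g, 'm) monoid_scheme \<Rightarrow>
   (complex \<Rightarrow> 'v::ab_group_add \<Rightarrow> 'v) \<Rightarrow> 'v set \<Rightarrow> ('g \<Rightarrow> 'v \<Rightarrow> 'v) \<Rightarrow>
   (complex \<Rightarrow> 'w::ab_group_add \<Rightarrow> 'w) \<Rightarrow> 'w set \<Rightarrow> ('g \<Rightarrow> 'w \<Rightarrow> 'w) \<Rightarrow> bool" where
  "rep_isomorphic G s V \<rho> t W \<sigma> \<longleftrightarrow>
     (\<exists>\<phi>. linear_between s V t W \<phi> \<and> bij_betw \<phi> V W \<and>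
          (\<forall>g\<in>carrier G. \<forall>v\<in>V. \<phi> (\<rho> g v) = \<sigma> g (\<phi> v)))"

definition group_centre :: "('g, 'm) monoid_scheme \<Rightarrow> 'g set" where
  "group_centre G = {z \<in> carrier G. \<forall>g\<in>carrier G. z \<otimes>\<^bsub>G\<^esub> g = g \<otimes>\<^bsub>G\<^esub> z}"

text \<open>In the following notions \<open>\<mu>\<close> is the group of complex numbers in which central
  characters take their values; for the Heisenberg group it is \<open>\<mu>\<^sub>R\<close>.\<close>

definition has_central_character ::
  "('g, 'm) monoid_scheme \<Rightarrow> complex set \<Rightarrow> (complex \<Rightarrow> 'v::ab_group_add \<Rightarrow> 'v) \<Rightarrow> 'v set \<Rightarrow>
   ('g \<Rightarrow> 'v \<Rightarrow> 'v) \<Rightarrow> ('g \<Rightarrow> complex) \<Rightarrow> bool" where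
  "has_central_character G \<mu> s V \<rho> \<psi> \<longleftrightarrow>
     \<psi> \<in> group_centre G \<rightarrow> \<mu> \<and> (\<forall>z\<in>group_centre G. \<forall>v\<in>V. \<rho> z v = s (\<psi> z) v)"

definition centrally_faithful ::
  "('g, 'm) monoid_scheme \<Rightarrow> complex set \<Rightarrow> (complex \<Rightarrow> 'v::ab_group_add \<Rightarrow> 'v) \<Rightarrow> 'v set \<Rightarrow>
   ('g \<Rightarrow> 'v \<Rightarrow> 'v) \<Rightarrow> bool" where
  "centrally_faithful G \<mu> s V \<rho> \<longleftrightarrow> group_rep G s V \<rho> \<and>
     (\<exists>\<psi>. has_central_character G \<mu> s V \<rho> \<psi> \<and> (\<exists>z\<in>group_centre G. \<psi> z \<noteq> 1))"

definition frobenius_indecomposable ::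
  "('g, 'm) monoid_scheme \<Rightarrow> complex set \<Rightarrow> (complex \<Rightarrow> 'v::ab_group_add \<Rightarrow> 'v) \<Rightarrow> 'v set \<Rightarrow>
   ('g \<Rightarrow> 'v \<Rightarrow> 'v) \<Rightarrow> bool" where
  "frobenius_indecomposable G \<mu> s V \<rho> \<longleftrightarrow> centrally_faithful G \<mu> s V \<rho> \<and>
     \<not> (\<exists>W. subrep G s V \<rho> W \<and> W \<noteq> {0} \<and> W \<noteq> V \<and>
            centrally_faithful G \<mu> s W (\<lambda>g. restrict (\<rho> g) W))"

definition frobenius_indecomposable_wrt ::
  "('g, 'm) monoid_scheme \<Rightarrow> complex set \<Rightarrow> (complex \<Rightarrow> 'v::ab_group_add \<Rightarrow> 'v) \<Rightarrow> 'v set \<Rightarrow>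
   ('g \<Rightarrow> 'v \<Rightarrow> 'v) \<Rightarrow> ('g \<Rightarrow> complex) \<Rightarrow> bool" where
  "frobenius_indecomposable_wrt G \<mu> s V \<rho> \<psi> \<longleftrightarrow>
     frobenius_indecomposable G \<mu> s V \<rho> \<and> has_central_character G \<mu> s V \<rho> \<psi>"


section \<open>The Frobenius Heisenberg group and its Schroedinger representation\<close>

definition heisenberg ::
  "('r::{comm_ring_1,finite} \<Rightarrow> complex) \<Rightarrow> ('r ^ 'n \<Rightarrow> 'r ^ 'n \<Rightarrow> 'r) \<Rightarrow>
   (('r ^ 'n) \<times> ('r ^ 'n) \<times> complex) monoid" where
  "heisenberg \<epsilon> \<beta> =
     \<lparr>carrier = UNIV \<times> UNIV \<times> range \<epsilon>,
      mult = (\<lambda>(x, y, l) (x', y', m). (x + x', y + y', l * m * \<epsilon> (\<beta> y' x))),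
      one = (0, 0, 1)\<rparr>"

text \<open>The identity character of \<open>\<mu>\<^sub>R\<close>, transported to the centre
  \<open>{(0, 0, \<lambda>) | \<lambda> \<in> \<mu>\<^sub>R}\<close> of the Heisenberg group; see \<open>heisenberg_centre\<close> below.\<close>

definition heisenberg_omega :: "('r ^ 'n) \<times> ('r ^ 'n) \<times> complex \<Rightarrow> complex" where
  "heisenberg_omega = (\<lambda>(x, y, l). l)"

definition fun_scale :: "complex \<Rightarrow> ('a \<Rightarrow> complex) \<Rightarrow> 'a \<Rightarrow> complex" where
  "fun_scale c f = (\<lambda>u. c * f u)"

definition translation :: "'r::comm_ring_1 ^ 'n \<Rightarrow> ('r ^ 'n \<Rightarrow> complex) \<Rightarrow> 'r ^ 'n \<Rightarrow> complex" where
  "translation x f = (\<lambda>u. f (u + x))"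

definition modulation ::
  "('r::comm_ring_1 \<Rightarrow> complex) \<Rightarrow> ('r ^ 'n \<Rightarrow> 'r ^ 'n \<Rightarrow> 'r) \<Rightarrow> 'r ^ 'n \<Rightarrow>
   ('r ^ 'n \<Rightarrow> complex) \<Rightarrow> 'r ^ 'n \<Rightarrow> complex" where
  "modulation \<epsilon> \<beta> y f = (\<lambda>u. \<epsilon> (\<beta> y u) * f u)"

definition schroedinger ::
  "('r::comm_ring_1 \<Rightarrow> complex) \<Rightarrow> ('r ^ 'n \<Rightarrow> 'r ^ 'n \<Rightarrow> 'r) \<Rightarrow>
   ('r ^ 'n) \<times> ('r ^ 'n) \<times> complex \<Rightarrow> ('r ^ 'n \<Rightarrow> complex) \<Rightarrow> 'r ^ 'n \<Rightarrow> complex" where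
  "schroedinger \<epsilon> \<beta> = (\<lambda>(x, y, l) f. fun_scale l (modulation \<epsilon> \<beta> y (translation x f)))"


section \<open>The Heisenberg group is a group with the expected centre\<close>

lemma additive_character_0: "additive_character \<epsilon> \<Longrightarrow> \<epsilon> 0 = 1"
  unfolding additive_character_def by (metis add_0 mult_cancel_right1)

lemma bilinear_pairing_simps:
  assumes "bilinear_pairing \<beta>"
  shows "\<beta> (y + y') x = \<beta> y x + \<beta> y' x" "\<beta> y (x + x') = \<beta> y x + \<beta> y x'"
    "\<beta> 0 x = 0" "\<beta> y 0 = 0" "\<beta> (- y) x = - \<beta> y x" "\<beta> y (- x) = - \<beta> y x"
proof -
  have 1: "module_hom (*s) (*) (\<lambda>x. \<beta> y x)" and 2: "module_hom (*s) (*) (\<lambda>y. \<beta> y x)" for x y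
    using assms by (auto simp: bilinear_pairing_def)
  show "\<beta> (y + y') x = \<beta> y x + \<beta> y' x" "\<beta> y (x + x') = \<beta> y x + \<beta> y x'"
    "\<beta> 0 x = 0" "\<beta> y 0 = 0" "\<beta> (- y) x = - \<beta> y x" "\<beta> y (- x) = - \<beta> y x"
    using module_hom.add[OF 1] module_hom.add[OF 2] module_hom.zero[OF 1] module_hom.zero[OF 2]
      module_hom.neg[OF 1] module_hom.neg[OF 2] by auto
qed

lemma heisenberg_group:
  assumes e: "generating_character \<epsilon>" and b: "bilinear_pairing \<beta>"
  shows "group (heisenberg \<epsilon> \<beta>)"
proof -
  have a: "\<epsilon> (x + y) = \<epsilon> x * \<epsilon> y" "\<epsilon> x \<noteq> 0" for x y
    using e by (auto simp: generating_character_def additive_character_def)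
  have e0: "\<epsilon> 0 = 1"
    using e by (simp add: generating_character_def additive_character_0)
  have closed: "\<epsilon> x * (\<epsilon> y * \<epsilon> z) \<in> range \<epsilon>" for x y z
    by (metis a(1) rangeI)
  have inv: "\<epsilon> (y - x) * \<epsilon> x * \<epsilon> (- y) = 1" for x y
    by (simp flip: a(1) add: e0)
  show ?thesis
  proof (rule groupI)
    show "\<exists>h\<in>carrier (heisenberg \<epsilon> \<beta>). h \<otimes>\<^bsub>heisenberg \<epsilon> \<beta>\<^esub> g = \<one>\<^bsub>heisenberg \<epsilon> \<beta>\<^esub>"
      if "g \<in> carrier (heisenberg \<epsilon> \<beta>)" for g
    proof -
      obtain x y c where g: "g = (x, y, \<epsilon> c)"
        using \<open>g \<in> carrier _\<close> by (auto simp: heisenberg_def)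
      show ?thesis
        by (rule bexI[of _ "(- x, - y, \<epsilon> (- c + \<beta> y x))"])
           (auto simp: heisenberg_def g bilinear_pairing_simps[OF b] inv)
    qed
  qed (use e0 in \<open>auto simp: heisenberg_def bilinear_pairing_simps[OF b] a(1) closed algebra_simps
      intro: rangeI[of _ 0, simplified] image_eqI[of 1 _ 0]\<close>)
qed

lemma heisenberg_centre:
  assumes e: "generating_character \<epsilon>" and b: "bilinear_pairing \<beta>"
    and nd: "nondegenerate_pairing \<epsilon> \<beta>"
  shows "group_centre (heisenberg \<epsilon> \<beta>) = {(0, 0, l) |l. l \<in> range \<epsilon>}"
proof -
  have nz: "\<epsilon> c \<noteq> 0" for c
    using e by (auto simp: generating_character_def additive_character_def)
  have e0: "\<epsilon> 0 = 1"
    using e by (simp add: generating_character_def additive_character_0)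
  have "x = 0 \<and> y = 0" if c: "(x, y, \<epsilon> c) \<in> group_centre (heisenberg \<epsilon> \<beta>)" for x y c
  proof -
    have eq: "\<epsilon> (\<beta> y' x) = \<epsilon> (\<beta> y x')" for x' y'
    proof -
      have "(x, y, \<epsilon> c) \<otimes>\<^bsub>heisenberg \<epsilon> \<beta>\<^esub> (x', y', \<epsilon> 0)
          = (x', y', \<epsilon> 0) \<otimes>\<^bsub>heisenberg \<epsilon> \<beta>\<^esub> (x, y, \<epsilon> c)"
        using c unfolding group_centre_def by (auto simp: heisenberg_def)
      then show ?thesis by (simp add: heisenberg_def nz e0)
    qed
    have "\<epsilon> (\<beta> y' x) = 1" for y' using eq[of y' 0] by (simp add: bilinear_pairing_simps[OF b] e0)
    moreover have "\<epsilon> (\<beta> y x') = 1" for x'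
      using eq[of 0 x'] by (simp add: bilinear_pairing_simps[OF b] e0)
    ultimately show ?thesis using nd by (auto simp: nondegenerate_pairing_def)
  qed
  moreover have "(0, 0, \<epsilon> c) \<in> group_centre (heisenberg \<epsilon> \<beta>)" for c
    by (auto simp: group_centre_def heisenberg_def bilinear_pairing_simps[OF b] e0)
  moreover have "\<exists>x y c. z = (x, y, \<epsilon> c)" if "z \<in> group_centre (heisenberg \<epsilon> \<beta>)" for z
    using that by (auto simp: group_centre_def heisenberg_def)
  ultimately show ?thesis by blast
qed

end

theory Submission
  imports Defs
begin

text \<open>Averaging a vector against the characters \<open>y \<mapsto> \<epsilon> (\<beta> y u)\<close> splits every representation
  with central character \<open>\<omega>\<close> into joint eigenspaces of the operators \<open>\<rho> (0, y, 1)\<close>. If \<open>w\<close> is an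
  eigenvector for \<open>u\<close>, then \<open>\<rho> (u - a, 0, 1) w\<close> is an eigenvector for \<open>a\<close>, and mapping the delta
  function at \<open>a\<close> to it is an injective intertwiner from the Schroedinger representation. Its image
  is a subrepresentation, hence everything when the target is Frobenius indecomposable.\<close>

section \<open>Representations on subspaces\<close>

text \<open>\<open>f\<close> is additive only on \<open>V\<close>, so the induction needs every
  partial sum to lie in \<open>V\<close>.\<close>

lemma linear_between_sum:
  assumes s: "vector_space s" and V: "module.subspace s V" and f: "linear_between s V t W f"
    and A: "finite A" and g: "\<And>a. a \<in> A \<Longrightarrow> g a \<in> V"
  shows "f (\<Sum>a\<in>A. g a) = (\<Sum>a\<in>A. f (g a))"
proof -
  interpret vector_space s by (rule s)
  have add: "f (u + v) = f u + f v" if "u \<in> V" "v \<in> V" for u v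
    using f that by (simp add: linear_between_def)
  have "f 0 + f 0 = f 0"
    using add[of 0 0] subspace_0[OF V] by simp
  then have f0: "f 0 = 0" by simp
  show ?thesis
    using A g
  proof (induction A rule: finite_induct)
    case (insert a A)
    then have "(\<Sum>a\<in>A. g a) \<in> V"
      by (intro subspace_sum[OF V]) auto
    with insert show ?case by (simp add: add)
  qed (simp add: f0)
qed

text \<open>Bijectivity comes for free: multiplicativity and the unit law make the operator of the
  inverse element a two-sided inverse on \<open>V\<close>. Extensionality is asked for because
  \<open>Bij V\<close> consists of extensional functions.\<close>

lemma group_repI:
  assumes G: "group G" and s: "vector_space s" and V: "module.subspace s V" "V \<noteq> {0}"
    and lin: "\<And>g. g \<in> carrier G \<Longrightarrow> linear_between s V s V (\<rho> g)"
    and ext: "\<And>g. g \<in> carrier G \<Longrightarrow> \<rho> g \<in> extensional V"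
    and mult: "\<And>g h v. g \<in> carrier G \<Longrightarrow> h \<in> carrier G \<Longrightarrow> v \<in> V \<Longrightarrow>
                 \<rho> (g \<otimes>\<^bsub>G\<^esub> h) v = \<rho> g (\<rho> h v)"
    and one: "\<And>v. v \<in> V \<Longrightarrow> \<rho> \<one>\<^bsub>G\<^esub> v = v"
  shows "group_rep G s V \<rho>"
proof -
  interpret group G by (rule G)
  have closed: "\<rho> g v \<in> V" if "g \<in> carrier G" "v \<in> V" for g v
    using lin[OF that(1)] that(2) by (auto simp: linear_between_def)
  have "bij_betw (\<rho> g) V V" if g: "g \<in> carrier G" for g
  proof (rule bij_betw_byWitness[where f' = "\<rho> (inv\<^bsub>G\<^esub> g)"])
    show "\<forall>v\<in>V. \<rho> (inv\<^bsub>G\<^esub> g) (\<rho> g v) = v" "\<forall>v\<in>V. \<rho> g (\<rho> (inv\<^bsub>G\<^esub> g) v) = v"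
      using g by (auto simp flip: mult simp: one)
  qed (use g closed in auto)
  then have "\<rho> g \<in> Bij V" if "g \<in> carrier G" for g
    using that ext by (simp add: Bij_def)
  moreover have "\<rho> (g \<otimes>\<^bsub>G\<^esub> h) = compose V (\<rho> g) (\<rho> h)"
    if "g \<in> carrier G" "h \<in> carrier G" for g h
    by (rule extensionalityI[where A = V])
       (use that ext in \<open>auto simp: mult compose_def\<close>)
  ultimately have "\<rho> \<in> hom G (GL s V)"
    by (auto simp: hom_def GL_def BijGroup_def lin)
  then show ?thesis
    using s V by (simp add: group_rep_def)
qed

lemma group_repD:
  assumes G: "group G" and r: "group_rep G s V \<rho>"
  shows "g \<in> carrier G \<Longrightarrow> linear_between s V s V (\<rho> g)"
    and "g \<in> carrier G \<Longrightarrow> v \<in> V \<Longrightarrow> \<rho> g v \<in> V"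
    and "g \<in> carrier G \<Longrightarrow> h \<in> carrier G \<Longrightarrow> v \<in> V \<Longrightarrow> \<rho> (g \<otimes>\<^bsub>G\<^esub> h) v = \<rho> g (\<rho> h v)"
    and "v \<in> V \<Longrightarrow> \<rho> \<one>\<^bsub>G\<^esub> v = v"
proof -
  interpret group G by (rule G)
  have h: "\<rho> \<in> hom G (GL s V)" using r by (simp add: group_rep_def)
  have c: "\<rho> g \<in> Bij V" "linear_between s V s V (\<rho> g)" if "g \<in> carrier G" for g
    using h that by (auto simp: hom_def GL_def)
  then show "g \<in> carrier G \<Longrightarrow> linear_between s V s V (\<rho> g)" by blast
  show closed: "\<rho> g v \<in> V" if "g \<in> carrier G" "v \<in> V" for g v
    using c(2)[OF that(1)] that(2) by (auto simp: linear_between_def)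
  show mult: "\<rho> (g \<otimes>\<^bsub>G\<^esub> h) v = \<rho> g (\<rho> h v)"
    if "g \<in> carrier G" "h \<in> carrier G" "v \<in> V" for g h v
    using hom_mult[OF h that(1,2)] c that by (simp add: GL_def BijGroup_def compose_def)
  show "\<rho> \<one>\<^bsub>G\<^esub> v = v" if "v \<in> V"
  proof -
    \<comment> \<open>Membership in \<open>hom\<close> gives multiplicativity only. The operator of
      the unit is therefore idempotent, and an injective idempotent map is the identity.\<close>
    have "inj_on (\<rho> \<one>\<^bsub>G\<^esub>) V"
      using c by (auto simp: Bij_def bij_betw_def)
    moreover have "\<rho> \<one>\<^bsub>G\<^esub> (\<rho> \<one>\<^bsub>G\<^esub> v) = \<rho> \<one>\<^bsub>G\<^esub> v"
      using mult[of "\<one>\<^bsub>G\<^esub>" "\<one>\<^bsub>G\<^esub>" v] that by simp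
    ultimately show ?thesis
      using that closed by (auto dest: inj_onD)
  qed
qed

text \<open>Inclusion of the images in \<open>W\<close> suffices: surjectivity on \<open>W\<close>
  follows since \<open>W\<close> is also stable under inverse group elements.\<close>

lemma subrep_group_rep:
  assumes G: "group G" and r: "group_rep G s V \<rho>" and W: "subrep G s V \<rho> W" "W \<noteq> {0}"
  shows "group_rep G s W (\<lambda>g. restrict (\<rho> g) W)"
proof -
  interpret group G by (rule G)
  have s: "vector_space s" using r by (simp add: group_rep_def)
  interpret vector_space s by (rule s)
  have sub: "subspace W" "W \<subseteq> V" and inv: "\<And>g w. g \<in> carrier G \<Longrightarrow> w \<in> W \<Longrightarrow> \<rho> g w \<in> W"
    using W by (auto simp: subrep_def)
  note D = group_repD[OF G r]
  show ?thesis
  proof (rule group_repI[OF G s sub(1) W(2)])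
    show "linear_between s W s W (restrict (\<rho> g) W)" if "g \<in> carrier G" for g
      using D(1)[OF that] sub inv that subspace_add[OF sub(1)] subspace_scale[OF sub(1)]
      by (auto simp: linear_between_def subset_iff)
  qed (use D sub inv in \<open>auto simp: subset_iff\<close>)
qed

text \<open>Every element of \<open>W\<close> has the form \<open>\<phi> v\<close>, so each property
  of the inverse map is checked on such elements, where it reduces to the same property of
  \<open>\<phi>\<close> at \<open>v\<close>.\<close>

lemma rep_isomorphic_sym:
  assumes G: "group G" and r: "group_rep G s V \<rho>" and i: "rep_isomorphic G s V \<rho> t W \<sigma>"
  shows "rep_isomorphic G t W \<sigma> s V \<rho>"
proof -
  interpret vector_space s using r by (simp add: group_rep_def)
  have V: "subspace V" using r by (simp add: group_rep_def)
  obtain \<phi> where lin: "linear_between s V t W \<phi>" and bij: "bij_betw \<phi> V W"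
    and eq: "\<And>g v. g \<in> carrier G \<Longrightarrow> v \<in> V \<Longrightarrow> \<phi> (\<rho> g v) = \<sigma> g (\<phi> v)"
    using i by (auto simp: rep_isomorphic_def)
  let ?\<psi> = "inv_into V \<phi>"
  have l: "?\<psi> (\<phi> v) = v" if "v \<in> V" for v
    using bij that by (simp add: bij_betw_inv_into_left)
  have W: "W = \<phi> ` V" using bij by (simp add: bij_betw_def)
  have 1: "?\<psi> (\<phi> u + \<phi> v) = u + v" if "u \<in> V" "v \<in> V" for u v
    using l[of "u + v"] lin that subspace_add[OF V] by (simp add: linear_between_def)
  have 2: "?\<psi> (t c (\<phi> v)) = s c v" if "v \<in> V" for c v
    using l[of "s c v"] lin that subspace_scale[OF V] by (simp add: linear_between_def)
  have 3: "?\<psi> (\<sigma> g (\<phi> v)) = \<rho> g v" if "g \<in> carrier G" "v \<in> V" for g v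
    using l[of "\<rho> g v"] eq[OF that] group_repD(2)[OF G r that] by simp
  show ?thesis
    unfolding rep_isomorphic_def
    by (rule exI[of _ ?\<psi>])
       (use bij_betw_inv_into[OF bij] in \<open>auto simp: linear_between_def W l 1 2 3\<close>)
qed

lemma rep_isomorphic_trans:
  assumes "rep_isomorphic G s V \<rho> t W \<sigma>" and "rep_isomorphic G t W \<sigma> r U \<tau>"
  shows "rep_isomorphic G s V \<rho> r U \<tau>"
proof -
  obtain \<phi> \<psi> where 1: "linear_between s V t W \<phi>" "bij_betw \<phi> V W"
      "\<And>g v. g \<in> carrier G \<Longrightarrow> v \<in> V \<Longrightarrow> \<phi> (\<rho> g v) = \<sigma> g (\<phi> v)"
    and 2: "linear_between t W r U \<psi>" "bij_betw \<psi> W U"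
      "\<And>g v. g \<in> carrier G \<Longrightarrow> v \<in> W \<Longrightarrow> \<psi> (\<sigma> g v) = \<tau> g (\<psi> v)"
    using assms by (auto simp: rep_isomorphic_def)
  show ?thesis
    unfolding rep_isomorphic_def
    by (rule exI[of _ "\<psi> \<circ> \<phi>"])
       (use 1 2 bij_betw_trans[OF 1(2) 2(2)] in \<open>auto simp: linear_between_def Pi_iff\<close>)
qed

section \<open>Character sums\<close>

text \<open>Translating the summation index by \<open>a\<close> multiplies the sum by
  \<open>\<psi> a\<close>, which differs from 1.\<close>

lemma sum_nontrivial_character:
  fixes \<psi> :: "'a::{ab_group_add,finite} \<Rightarrow> complex"
  assumes add: "\<And>a b. \<psi> (a + b) = \<psi> a * \<psi> b" and a: "\<psi> a \<noteq> 1"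
  shows "(\<Sum>b\<in>UNIV. \<psi> b) = 0"
proof -
  have "(\<Sum>b\<in>UNIV. \<psi> b) = (\<Sum>b\<in>UNIV. \<psi> (a + b))"
    by (rule sum.reindex_bij_witness[of _ "\<lambda>b. a + b" "\<lambda>b. b - a"]) auto
  also have "\<dots> = \<psi> a * (\<Sum>b\<in>UNIV. \<psi> b)"
    by (simp add: add sum_distrib_left)
  finally show ?thesis using a by simp
qed

locale heisenberg_pairing =
  fixes \<epsilon> :: "'r::{comm_ring_1,finite} \<Rightarrow> complex" and \<beta> :: "'r ^ 'n \<Rightarrow> 'r ^ 'n \<Rightarrow> 'r"
  assumes gen: "generating_character \<epsilon>"
    and bil: "bilinear_pairing \<beta>"
    and nondeg: "nondegenerate_pairing \<epsilon> \<beta>"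
begin

abbreviation "H \<equiv> heisenberg \<epsilon> \<beta>"

lemmas group_H = heisenberg_group[OF gen bil]
lemmas centre_H = heisenberg_centre[OF gen bil nondeg]
lemmas beta_simps = bilinear_pairing_simps[OF bil]

lemma beta_diff: "\<beta> (y - y') x = \<beta> y x - \<beta> y' x" "\<beta> y (x - x') = \<beta> y x - \<beta> y x'"
  using beta_simps(1)[of y "- y'" x] beta_simps(2)[of y x "- x'"] by (simp_all add: beta_simps)

lemma eps_add: "\<epsilon> (a + b) = \<epsilon> a * \<epsilon> b"
  using gen by (auto simp: generating_character_def additive_character_def)

lemma eps_0 [simp]: "\<epsilon> 0 = 1"
  using gen by (simp add: generating_character_def additive_character_0)

lemma eps_neg_mult: "\<epsilon> (- a) * \<epsilon> b = \<epsilon> (b - a)"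
  by (simp flip: eps_add)

lemma one_in_range [simp, intro]: "1 \<in> range \<epsilon>"
  by (metis eps_0 rangeI)

text \<open>Otherwise the whole ring would be an ideal in the kernel of \<open>\<epsilon>\<close>,
  hence zero. This is what makes \<omega> a nontrivial character of the centre.\<close>

lemma eps_nontrivial: "\<exists>a. \<epsilon> a \<noteq> 1"
proof (rule ccontr)
  assume "\<not> ?thesis"
  then have "(UNIV :: 'r set) = {0}"
    using gen by (auto simp: generating_character_def left_ideal_def)
  then show False
    by (metis UNIV_I singletonD zero_neq_one)
qed

text \<open>Orthogonality of characters: for nonzero \<open>x\<close>, nondegeneracy makes the
  summand a nontrivial character in \<open>y\<close>. Summing over \<open>y\<close> in this way
  isolates a single point of \<open>R^n\<close>.\<close>

lemma sum_eps_right: "(\<Sum>y\<in>UNIV. \<epsilon> (\<beta> y x)) = (if x = 0 then of_nat CARD('r ^ 'n) else 0)"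
proof (cases "x = 0")
  case False
  then obtain y where "\<epsilon> (\<beta> y x) \<noteq> 1"
    using nondeg by (auto simp: nondegenerate_pairing_def)
  then show ?thesis
    using False sum_nontrivial_character[of "\<lambda>y. \<epsilon> (\<beta> y x)"] by (simp add: beta_simps eps_add)
qed (simp add: beta_simps)

text \<open>The dual orthogonality relation, from the other half of nondegeneracy; it yields Fourier
  inversion in \<open>eigenvector_exists\<close>.\<close>

lemma sum_eps_left: "(\<Sum>x\<in>UNIV. \<epsilon> (\<beta> y x)) = (if y = 0 then of_nat CARD('r ^ 'n) else 0)"
proof (cases "y = 0")
  case False
  then obtain x where "\<epsilon> (\<beta> y x) \<noteq> 1"
    using nondeg by (auto simp: nondegenerate_pairing_def)
  then show ?thesis
    using False sum_nontrivial_character[of "\<lambda>x. \<epsilon> (\<beta> y x)"] by (simp add: beta_simps eps_add)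
qed (simp add: beta_simps)

section \<open>Representations with central character \<open>\<omega>\<close>\<close>

lemma has_central_character_iff:
  "has_central_character H (range \<epsilon>) s V \<rho> heisenberg_omega \<longleftrightarrow>
     (\<forall>l\<in>range \<epsilon>. \<forall>v\<in>V. \<rho> (0, 0, l) v = s l v)"
  by (auto simp: has_central_character_def centre_H heisenberg_omega_def)

lemma centrally_faithfulI:
  assumes "group_rep H s V \<rho>" "has_central_character H (range \<epsilon>) s V \<rho> heisenberg_omega"
  shows "centrally_faithful H (range \<epsilon>) s V \<rho>"
proof -
  have "\<exists>z\<in>group_centre H. heisenberg_omega z \<noteq> 1"
    using eps_nontrivial by (auto simp: centre_H heisenberg_omega_def)
  with assms show ?thesis by (auto simp: centrally_faithful_def)
qed

text \<open>A nonzero subrepresentation inherits the central character \<omega> and is thus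
  centrally faithful. Hence, for this central character, Frobenius indecomposability is ordinary
  irreducibility.\<close>

lemma frobenius_indecomposable_wrt_iff:
  "frobenius_indecomposable_wrt H (range \<epsilon>) s V \<rho> heisenberg_omega \<longleftrightarrow>
     group_rep H s V \<rho> \<and> has_central_character H (range \<epsilon>) s V \<rho> heisenberg_omega \<and>
     (\<forall>W. subrep H s V \<rho> W \<longrightarrow> W \<noteq> {0} \<longrightarrow> W = V)"
proof -
  have "centrally_faithful H (range \<epsilon>) s W (\<lambda>g. restrict (\<rho> g) W)"
    if "group_rep H s V \<rho>" "has_central_character H (range \<epsilon>) s V \<rho> heisenberg_omega"
      "subrep H s V \<rho> W" "W \<noteq> {0}" for W
  proof (rule centrally_faithfulI)
    show "group_rep H s W (\<lambda>g. restrict (\<rho> g) W)"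
      using subrep_group_rep[OF group_H that(1,3,4)] .
    show "has_central_character H (range \<epsilon>) s W (\<lambda>g. restrict (\<rho> g) W) heisenberg_omega"
      using that(2,3) by (auto simp: has_central_character_iff subrep_def subset_iff)
  qed
  moreover have "centrally_faithful H (range \<epsilon>) s V \<rho> \<longleftrightarrow> group_rep H s V \<rho>"
    if "has_central_character H (range \<epsilon>) s V \<rho> heisenberg_omega"
    using centrally_faithfulI[OF _ that] by (auto simp: centrally_faithful_def)
  ultimately show ?thesis
    unfolding frobenius_indecomposable_wrt_def frobenius_indecomposable_def by metis
qed

end

section \<open>Commutation relations, joint eigenvectors and the embedding of the Schroedinger
  representation\<close>

locale omega_rep = heisenberg_pairing \<epsilon> \<beta> + vector_space s
  for \<epsilon> :: "'r::{comm_ring_1,finite} \<Rightarrow> complex" and \<beta> :: "'r ^ 'n \<Rightarrow> 'r ^ 'n \<Rightarrow> 'r"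
    and s :: "complex \<Rightarrow> 'v::ab_group_add \<Rightarrow> 'v" +
  fixes V :: "'v set" and \<rho> :: "('r ^ 'n) \<times> ('r ^ 'n) \<times> complex \<Rightarrow> 'v \<Rightarrow> 'v"
  assumes rep: "group_rep H s V \<rho>"
    and omega: "has_central_character H (range \<epsilon>) s V \<rho> heisenberg_omega"
begin

abbreviation "A x \<equiv> \<rho> (x, 0, 1)"
abbreviation "B y \<equiv> \<rho> (0, y, 1)"

lemma V: "subspace V" "V \<noteq> {0}"
  using rep by (auto simp: group_rep_def)

lemmas V_closed [intro] = subspace_add[OF V(1)] subspace_scale[OF V(1)] subspace_sum[OF V(1)]

lemma carrier_H [simp]: "(x, y, l) \<in> carrier H \<longleftrightarrow> l \<in> range \<epsilon>"
  by (auto simp: heisenberg_def)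

lemma rho_linear: "l \<in> range \<epsilon> \<Longrightarrow> linear_between s V s V (\<rho> (x, y, l))"
  by (rule group_repD(1)[OF group_H rep]) simp

lemma rho_closed [intro]: "l \<in> range \<epsilon> \<Longrightarrow> v \<in> V \<Longrightarrow> \<rho> (x, y, l) v \<in> V"
  by (rule group_repD(2)[OF group_H rep]) auto

lemma rho_scale: "l \<in> range \<epsilon> \<Longrightarrow> v \<in> V \<Longrightarrow> \<rho> (x, y, l) (s c v) = s c (\<rho> (x, y, l) v)"
  using rho_linear by (auto simp: linear_between_def)

lemma rho_zero: "l \<in> range \<epsilon> \<Longrightarrow> \<rho> (x, y, l) 0 = 0"
  using rho_scale[of l 0 x y 0] subspace_0[OF V(1)] by simp

lemma rho_sum:
  assumes "l \<in> range \<epsilon>" "\<And>a. a \<in> I \<Longrightarrow> f a \<in> V" "finite I"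
  shows "\<rho> (x, y, l) (\<Sum>a\<in>I. f a) = (\<Sum>a\<in>I. \<rho> (x, y, l) (f a))"
  by (rule linear_between_sum[OF vector_space_axioms V(1) rho_linear[OF assms(1)]])
     (use assms in auto)

lemma rho_mult:
  assumes "l \<in> range \<epsilon>" "m \<in> range \<epsilon>" "v \<in> V"
  shows "\<rho> (x, y, l) (\<rho> (x', y', m) v) = \<rho> (x + x', y + y', l * m * \<epsilon> (\<beta> y' x)) v"
  using group_repD(3)[OF group_H rep, of "(x, y, l)" "(x', y', m)" v] assms
  by (simp add: heisenberg_def)

lemma rho_central: "l \<in> range \<epsilon> \<Longrightarrow> v \<in> V \<Longrightarrow> \<rho> (0, 0, l) v = s l v"
  using omega by (auto simp: has_central_character_iff)

lemma A_A: "v \<in> V \<Longrightarrow> A x (A x' v) = A (x + x') v"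
  and B_B: "v \<in> V \<Longrightarrow> B y (B y' v) = B (y + y') v"
  by (simp_all add: rho_mult beta_simps)

lemma rho_0: "v \<in> V \<Longrightarrow> \<rho> (0, 0, 1) v = v"
  by (simp add: rho_central)

text \<open>In the group, \<open>(x, y, l) = (0, 0, l) (0, y, 1) (x, 0, 1)\<close>; multiplied in
  this order, the factors produce no cocycle term.\<close>

lemma rho_decompose:
  assumes "l \<in> range \<epsilon>" "v \<in> V"
  shows "\<rho> (x, y, l) v = s l (B y (A x v))"
proof -
  have "s l (B y (A x v)) = \<rho> (0, 0, l) (B y (A x v))"
    using assms by (intro rho_central[symmetric]) auto
  also have "\<dots> = \<rho> (x, y, l) v"
    using assms by (auto simp: rho_mult beta_simps)
  finally show ?thesis by simp
qed

text \<open>The Weyl commutation relation: the opposite product \<open>(x, 0, 1) (0, y, 1)\<close>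
  picks up the central factor \<open>\<epsilon> (\<beta> y x)\<close>.\<close>

lemma B_A:
  assumes "v \<in> V"
  shows "B y (A x v) = s (\<epsilon> (- \<beta> y x)) (A x (B y v))"
proof -
  have "A x (B y v) = s (\<epsilon> (\<beta> y x)) (B y (A x v))"
    using assms rho_decompose[of "\<epsilon> (\<beta> y x)" v x y] by (simp add: rho_mult)
  then show ?thesis by (simp add: eps_neg_mult)
qed

lemma eigenvector_exists: "\<exists>u w. w \<in> V \<and> w \<noteq> 0 \<and> (\<forall>y. B y w = s (\<epsilon> (\<beta> y u)) w)"
proof -
  obtain v where v: "v \<in> V" "v \<noteq> 0"
    using V subspace_0 by blast
  \<comment> \<open>Up to the factor \<open>CARD('r ^ 'n)\<close>, \<open>E u\<close> is the
    projection of \<open>v\<close> to the joint eigenspace of the operators \<open>B y\<close>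
    belonging to \<open>u\<close>.\<close>
  define E where "E u = (\<Sum>y\<in>UNIV. s (\<epsilon> (- \<beta> y u)) (B y v))" for u
  have E_V: "E u \<in> V" for u
    unfolding E_def using v by auto
  have E_eigen: "B y (E u) = s (\<epsilon> (\<beta> y u)) (E u)" for y u
  proof -
    have "B y (E u) = (\<Sum>y'\<in>UNIV. s (\<epsilon> (- \<beta> y' u)) (B (y + y') v))"
      unfolding E_def using v by (subst rho_sum) (auto simp: rho_scale rho_closed B_B)
    also have "\<dots> = (\<Sum>y'\<in>UNIV. s (\<epsilon> (- \<beta> (y' - y) u)) (B y' v))"
      by (rule sum.reindex_bij_witness[of _ "\<lambda>y'. y' - y" "\<lambda>y'. y + y'"]) auto
    also have "\<dots> = s (\<epsilon> (\<beta> y u)) (E u)"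
      unfolding E_def by (simp add: scale_sum_right beta_diff flip: eps_add)
    finally show ?thesis .
  qed
  \<comment> \<open>Fourier inversion: summed over \<open>u\<close>, only the term
    \<open>y = 0\<close> survives, giving a nonzero multiple of \<open>v\<close>. So not all
    \<open>E u\<close> vanish.\<close>
  have "(\<Sum>u\<in>UNIV. E u) = (\<Sum>y\<in>UNIV. s (\<Sum>u\<in>UNIV. \<epsilon> (\<beta> (- y) u)) (B y v))"
    unfolding E_def by (subst sum.swap) (simp add: scale_sum_left beta_simps)
  also have "\<dots> = (\<Sum>y\<in>(UNIV :: ('r ^ 'n) set). if y = 0 then s (of_nat CARD('r ^ 'n)) v else 0)"
    unfolding sum_eps_left by (intro sum.cong) (auto simp: rho_0 v)
  also have "\<dots> \<noteq> 0"
    using v by simp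
  finally obtain u where "E u \<noteq> 0"
    by (metis sum.neutral)
  with E_V E_eigen show ?thesis by blast
qed

lemma schroedinger_embedding:
  "\<exists>\<Phi>. linear_between fun_scale UNIV s V \<Phi> \<and> inj \<Phi> \<and>
       (\<forall>g\<in>carrier H. \<forall>f. \<Phi> (schroedinger \<epsilon> \<beta> g f) = \<rho> g (\<Phi> f))"
proof -
  obtain u w where w: "w \<in> V" "w \<noteq> 0" and eig: "\<And>y. B y w = s (\<epsilon> (\<beta> y u)) w"
    using eigenvector_exists by blast
  \<comment> \<open>By \<open>B_A\<close>, applying \<open>A (u - a)\<close> turns the eigenvalue
    \<open>\<epsilon> (\<beta> y u)\<close> into \<open>\<epsilon> (\<beta> y a)\<close>. The sign
    matches \<open>translation x\<close>, which moves the delta function at \<open>a\<close> to the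
    one at \<open>a - x\<close>.\<close>
  define e where "e a = A (u - a) w" for a
  have e_V [intro]: "e a \<in> V" for a
    unfolding e_def using w by auto
  have "A (a - u) (e a) = w" for a
    unfolding e_def using w by (simp add: A_A rho_0)
  then have e_nonzero: "e a \<noteq> 0" for a
    using w by (metis one_in_range rho_zero)
  have A_e: "A x (e a) = e (a - x)" for x a
    unfolding e_def using w by (simp add: A_A algebra_simps)
  have B_e: "B y (e a) = s (\<epsilon> (\<beta> y a)) (e a)" for y a
    unfolding e_def using w by (simp add: B_A eig rho_scale beta_diff flip: eps_add)
  define \<Phi> where "\<Phi> f = (\<Sum>a\<in>UNIV. s (f a) (e a))" for f
  have \<Phi>_V [intro]: "\<Phi> f \<in> V" for f
    unfolding \<Phi>_def by auto
  have add: "\<Phi> (f + g) = \<Phi> f + \<Phi> g" for f g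
    unfolding \<Phi>_def by (simp add: scale_left_distrib sum.distrib)
  have scale: "\<Phi> (fun_scale c f) = s c (\<Phi> f)" for c f
    unfolding \<Phi>_def by (simp add: fun_scale_def scale_sum_right)
  have A_\<Phi>: "A x (\<Phi> f) = \<Phi> (translation x f)" for x f
  proof -
    have "A x (\<Phi> f) = (\<Sum>a\<in>UNIV. s (f a) (e (a - x)))"
      unfolding \<Phi>_def by (subst rho_sum) (auto simp: rho_scale e_V A_e)
    also have "\<dots> = \<Phi> (translation x f)"
      unfolding \<Phi>_def translation_def
      by (rule sum.reindex_bij_witness[of _ "\<lambda>a. a + x" "\<lambda>a. a - x"]) auto
    finally show ?thesis .
  qed
  have B_\<Phi>: "B y (\<Phi> f) = \<Phi> (modulation \<epsilon> \<beta> y f)" for y f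
    unfolding \<Phi>_def modulation_def
    by (subst rho_sum) (auto simp: rho_scale e_V B_e mult.commute)
  have equivariant: "\<Phi> (schroedinger \<epsilon> \<beta> g f) = \<rho> g (\<Phi> f)" if "g \<in> carrier H" for g f
    using that by (cases g) (auto simp: schroedinger_def scale A_\<Phi> B_\<Phi> rho_decompose \<Phi>_V)
  \<comment> \<open>Averaging \<open>\<Phi> f\<close> against the character belonging to
    \<open>a\<close> leaves only \<open>f a\<close> times \<open>e a\<close>, scaled by
    \<open>CARD('r ^ 'n)\<close>. As \<open>e a\<close> is nonzero, \<open>f a\<close> must
    vanish.\<close>
  have kernel: "f = 0" if "\<Phi> f = 0" for f
  proof
    fix a
    have "0 = (\<Sum>y\<in>UNIV. s (\<epsilon> (- \<beta> y a)) (B y (\<Phi> f)))"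
      by (simp add: that rho_zero)
    also have "\<dots> = (\<Sum>b\<in>UNIV. s ((\<Sum>y\<in>UNIV. \<epsilon> (\<beta> y (b - a))) * f b) (e b))"
      unfolding B_\<Phi> unfolding \<Phi>_def modulation_def scale_sum_right
      by (subst sum.swap)
         (simp add: sum_distrib_right scale_sum_left beta_diff mult.assoc flip: eps_neg_mult)
    also have "\<dots> = (\<Sum>b\<in>UNIV. if b = a then s (of_nat CARD('r ^ 'n) * f a) (e a) else 0)"
      unfolding sum_eps_right by (intro sum.cong) auto
    finally show "f a = 0 a"
      using e_nonzero by simp
  qed
  have "inj \<Phi>"
  proof (rule injI)
    fix f g assume "\<Phi> f = \<Phi> g"
    then have "\<Phi> (f - g) = 0"
      using add[of "f - g" g] by simp
    then show "f = g"
      using kernel[of "f - g"] by simp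
  qed
  with add scale equivariant show ?thesis
    by (intro exI[of _ \<Phi>]) (auto simp: linear_between_def)
qed

text \<open>The image of the embedding is invariant by equivariance and nonzero by injectivity, so
  irreducibility makes the embedding surjective.\<close>

lemma schroedinger_isomorphic:
  assumes irred: "\<And>W. subrep H s V \<rho> W \<Longrightarrow> W \<noteq> {0} \<Longrightarrow> W = V"
  shows "rep_isomorphic H fun_scale UNIV (schroedinger \<epsilon> \<beta>) s V \<rho>"
proof -
  obtain \<Phi> where lin: "linear_between fun_scale UNIV s V \<Phi>" and inj: "inj \<Phi>"
    and eq: "\<And>g f. g \<in> carrier H \<Longrightarrow> \<Phi> (schroedinger \<epsilon> \<beta> g f) = \<rho> g (\<Phi> f)"
    using schroedinger_embedding by blast
  have add: "\<Phi> (f + g) = \<Phi> f + \<Phi> g" and scale: "\<Phi> (fun_scale c f) = s c (\<Phi> f)" for f g c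
    using lin by (auto simp: linear_between_def)
  have zero: "\<Phi> 0 = 0"
    using add[of 0 0] by simp
  have "subspace (range \<Phi>)"
    by (rule subspaceI) (metis zero rangeI, (clarify, metis add scale rangeI)+)
  then have "subrep H s V \<rho> (range \<Phi>)"
    using lin by (auto simp: subrep_def linear_between_def simp flip: eq)
  moreover have "\<Phi> 1 \<noteq> 0"
  proof
    assume "\<Phi> 1 = 0"
    then have "(1 :: 'r ^ 'n \<Rightarrow> complex) = 0"
      using inj zero by (metis injD)
    then show False by (simp add: fun_eq_iff)
  qed
  then have "range \<Phi> \<noteq> {0}" by auto
  ultimately have "range \<Phi> = V" by (rule irred)
  with lin inj eq show ?thesis
    by (auto simp: rep_isomorphic_def bij_betw_def intro!: exI[of _ \<Phi>])
qed

end

section \<open>The Schroedinger representation\<close>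

lemma vector_space_fun_scale: "vector_space fun_scale"
  by unfold_locales (auto simp: fun_scale_def algebra_simps)

lemma sum_fun_apply: "(\<Sum>a\<in>I. f a) x = (\<Sum>a\<in>I. f a x)"
  by (induction I rule: infinite_finite_induct) auto

context heisenberg_pairing
begin

lemma schroedinger_apply: "schroedinger \<epsilon> \<beta> (x, y, l) f u = l * (\<epsilon> (\<beta> y u) * f (u + x))"
  by (simp add: schroedinger_def fun_scale_def modulation_def translation_def)

text \<open>The cocycle \<open>\<epsilon> (\<beta> y' x)\<close> of the group law is the factor that
  appears when translation by \<open>x\<close> is moved past modulation by
  \<open>y'\<close>.\<close>

lemma schroedinger_group_rep: "group_rep H fun_scale UNIV (schroedinger \<epsilon> \<beta>)"
proof (rule group_repI[OF group_H vector_space_fun_scale])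
  interpret vector_space fun_scale by (rule vector_space_fun_scale)
  show "subspace UNIV" by simp
  have "(1 :: 'r ^ 'n \<Rightarrow> complex) \<noteq> 0" by (simp add: fun_eq_iff)
  then show "(UNIV :: ('r ^ 'n \<Rightarrow> complex) set) \<noteq> {0}" by blast
  show "linear_between fun_scale UNIV fun_scale UNIV (schroedinger \<epsilon> \<beta> g)" for g
    by (cases g) (auto simp: linear_between_def fun_eq_iff schroedinger_apply fun_scale_def
        algebra_simps)
  show "schroedinger \<epsilon> \<beta> (g \<otimes>\<^bsub>H\<^esub> h) f = schroedinger \<epsilon> \<beta> g (schroedinger \<epsilon> \<beta> h f)" for g h f
    by (cases g; cases h)
       (auto simp: fun_eq_iff schroedinger_apply heisenberg_def beta_simps eps_add algebra_simps)
  show "schroedinger \<epsilon> \<beta> \<one>\<^bsub>H\<^esub> f = f" for f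
    by (auto simp: fun_eq_iff schroedinger_apply heisenberg_def beta_simps)
qed simp

lemma schroedinger_central_character:
  "has_central_character H (range \<epsilon>) fun_scale UNIV (schroedinger \<epsilon> \<beta>) heisenberg_omega"
  by (auto simp: has_central_character_iff fun_eq_iff schroedinger_apply beta_simps fun_scale_def)

text \<open>From a nonzero function in \<open>W\<close>, a character average extracts a delta
  function; translations then give all delta functions, and these span.\<close>

lemma schroedinger_irreducible:
  assumes W: "subrep H fun_scale UNIV (schroedinger \<epsilon> \<beta>) W" "W \<noteq> {0}"
  shows "W = UNIV"
proof -
  interpret vector_space fun_scale by (rule vector_space_fun_scale)
  have sub: "subspace W" using W by (simp add: subrep_def)
  have inv: "schroedinger \<epsilon> \<beta> (x, y, 1) f \<in> W" if "f \<in> W" for x y f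
  proof -
    have "(x, y, 1) \<in> carrier H" by (simp add: heisenberg_def)
    with W that show ?thesis by (auto simp: subrep_def)
  qed
  obtain f where f: "f \<in> W" "f \<noteq> 0"
    using W subspace_0[OF sub] by blast
  then obtain u where u: "f u \<noteq> 0" by (auto simp: fun_eq_iff)
  define \<delta> :: "'r ^ 'n \<Rightarrow> 'r ^ 'n \<Rightarrow> complex" where "\<delta> a b = (if b = a then 1 else 0)" for a b
  let ?N = "of_nat CARD('r ^ 'n) :: complex"
  \<comment> \<open>By orthogonality this average removes every value of \<open>f\<close> except the
    one at \<open>u\<close>, where \<open>f\<close> does not vanish.\<close>
  have "(\<Sum>y\<in>UNIV. fun_scale (\<epsilon> (- \<beta> y u)) (schroedinger \<epsilon> \<beta> (0, y, 1) f)) \<in> W"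
    by (intro subspace_sum[OF sub] subspace_scale[OF sub] inv f)
  also have "(\<Sum>y\<in>UNIV. fun_scale (\<epsilon> (- \<beta> y u)) (schroedinger \<epsilon> \<beta> (0, y, 1) f))
      = fun_scale (?N * f u) (\<delta> u)"
  proof
    fix b
    have "(\<Sum>y\<in>UNIV. fun_scale (\<epsilon> (- \<beta> y u)) (schroedinger \<epsilon> \<beta> (0, y, 1) f)) b
        = (\<Sum>y\<in>UNIV. \<epsilon> (\<beta> y (b - u))) * f b"
      by (simp add: sum_fun_apply fun_scale_def schroedinger_apply beta_diff sum_distrib_right
          mult.assoc flip: eps_neg_mult)
    then show "(\<Sum>y\<in>UNIV. fun_scale (\<epsilon> (- \<beta> y u)) (schroedinger \<epsilon> \<beta> (0, y, 1) f)) b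
        = fun_scale (?N * f u) (\<delta> u) b"
      by (simp add: sum_eps_right fun_scale_def \<delta>_def)
  qed
  finally have "fun_scale (inverse (?N * f u)) (fun_scale (?N * f u) (\<delta> u)) \<in> W"
    by (rule subspace_scale[OF sub])
  moreover have nonzero: "?N * f u \<noteq> 0"
    using u by simp
  ultimately have "\<delta> u \<in> W"
    by (simp only: scale_scale left_inverse[OF nonzero] scale_one)
  have "\<delta> a \<in> W" for a
  proof -
    \<comment> \<open>At \<open>b\<close> the left side is \<open>\<delta> u (b + u - a)\<close>,
      which is 1 exactly for \<open>b = a\<close>.\<close>
    have "schroedinger \<epsilon> \<beta> (u - a, 0, 1) (\<delta> u) = \<delta> a"
      by (auto simp: fun_eq_iff schroedinger_apply \<delta>_def beta_simps algebra_simps)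
    with inv[OF \<open>\<delta> u \<in> W\<close>] show ?thesis by metis
  qed
  then have "(\<Sum>a\<in>UNIV. fun_scale (g a) (\<delta> a)) \<in> W" for g
    by (intro subspace_sum[OF sub] subspace_scale[OF sub])
  moreover have "(\<Sum>a\<in>UNIV. fun_scale (g a) (\<delta> a)) = g" for g
    by (simp add: fun_eq_iff sum_fun_apply fun_scale_def \<delta>_def if_distrib cong: if_cong)
  ultimately show ?thesis by (metis UNIV_eq_I)
qed

lemma schroedinger_indecomposable:
  "frobenius_indecomposable_wrt H (range \<epsilon>) fun_scale UNIV (schroedinger \<epsilon> \<beta>) heisenberg_omega"
  using schroedinger_group_rep schroedinger_central_character schroedinger_irreducible
  by (auto simp: frobenius_indecomposable_wrt_iff)

text \<open>Both directions are recorded so that two indecomposable representations can be compared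
  through the Schroedinger representation.\<close>

lemma indecomposable_isomorphic_schroedinger:
  fixes s :: "complex \<Rightarrow> 'v::ab_group_add \<Rightarrow> 'v"
  assumes "frobenius_indecomposable_wrt H (range \<epsilon>) s V \<rho> heisenberg_omega"
  shows "rep_isomorphic H fun_scale UNIV (schroedinger \<epsilon> \<beta>) s V \<rho>"
    and "rep_isomorphic H s V \<rho> fun_scale UNIV (schroedinger \<epsilon> \<beta>)"
proof -
  have "vector_space s"
    using assms by (simp add: frobenius_indecomposable_wrt_iff group_rep_def)
  then interpret omega_rep \<epsilon> \<beta> s V \<rho>
    using assms heisenberg_pairing_axioms
    by (auto simp: omega_rep_def omega_rep_axioms_def frobenius_indecomposable_wrt_iff)
  show "rep_isomorphic H fun_scale UNIV (schroedinger \<epsilon> \<beta>) s V \<rho>"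
    using assms by (intro schroedinger_isomorphic) (auto simp: frobenius_indecomposable_wrt_iff)
  then show "rep_isomorphic H s V \<rho> fun_scale UNIV (schroedinger \<epsilon> \<beta>)"
    by (rule rep_isomorphic_sym[OF group_H schroedinger_group_rep])
qed

end

text \<open>The index type \<open>'n\<close> is finite and nonempty, which encodes
  \<open>n \<ge> 1\<close>. The type variables \<open>'v\<close> and \<open>'w\<close> are
  arbitrary, so uniqueness compares representations living in different types.\<close>

theorem theorem6p16:
  fixes \<epsilon> :: "'r::{comm_ring_1,finite} \<Rightarrow> complex"
    and \<beta> :: "'r ^ 'n \<Rightarrow> 'r ^ 'n \<Rightarrow> 'r"
  assumes "generating_character \<epsilon>"
    and "bilinear_pairing \<beta>"
    and "nondegenerate_pairing \<epsilon> \<beta>"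
  shows
    "(\<exists>(s :: complex \<Rightarrow> ('r ^ 'n \<Rightarrow> complex) \<Rightarrow> ('r ^ 'n \<Rightarrow> complex)) V \<rho>.
        centrally_faithful (heisenberg \<epsilon> \<beta>) (range \<epsilon>) s V \<rho> \<and>
        frobenius_indecomposable_wrt (heisenberg \<epsilon> \<beta>) (range \<epsilon>) s V \<rho> heisenberg_omega \<and>
        (\<forall>l\<in>range \<epsilon>. \<forall>v\<in>V. \<rho> (0, 0, l) v = s l v))
     \<and>
     (\<forall>(s :: complex \<Rightarrow> 'v::ab_group_add \<Rightarrow> 'v) V \<rho>
        (t :: complex \<Rightarrow> 'w::ab_group_add \<Rightarrow> 'w) W \<sigma>.
        frobenius_indecomposable_wrt (heisenberg \<epsilon> \<beta>) (range \<epsilon>) s V \<rho> heisenberg_omega \<longrightarrow>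
        frobenius_indecomposable_wrt (heisenberg \<epsilon> \<beta>) (range \<epsilon>) t W \<sigma> heisenberg_omega \<longrightarrow>
        rep_isomorphic (heisenberg \<epsilon> \<beta>) s V \<rho> t W \<sigma>)
     \<and>
     (frobenius_indecomposable_wrt (heisenberg \<epsilon> \<beta>) (range \<epsilon>)
        fun_scale UNIV (schroedinger \<epsilon> \<beta>) heisenberg_omega \<and>
      (\<forall>(s :: complex \<Rightarrow> 'v \<Rightarrow> 'v) V \<rho>.
        frobenius_indecomposable_wrt (heisenberg \<epsilon> \<beta>) (range \<epsilon>) s V \<rho> heisenberg_omega \<longrightarrow>
        rep_isomorphic (heisenberg \<epsilon> \<beta>) s V \<rho>
          fun_scale UNIV (schroedinger \<epsilon> \<beta>)))"
proof -
  interpret heisenberg_pairing \<epsilon> \<beta>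
    using assms by unfold_locales
  note \<pi> = schroedinger_indecomposable
  show ?thesis
  proof (intro conjI allI impI)
    show "\<exists>(s :: complex \<Rightarrow> ('r ^ 'n \<Rightarrow> complex) \<Rightarrow> ('r ^ 'n \<Rightarrow> complex)) V \<rho>.
        centrally_faithful H (range \<epsilon>) s V \<rho> \<and>
        frobenius_indecomposable_wrt H (range \<epsilon>) s V \<rho> heisenberg_omega \<and>
        (\<forall>l\<in>range \<epsilon>. \<forall>v\<in>V. \<rho> (0, 0, l) v = s l v)"
      using \<pi> schroedinger_central_character
        centrally_faithfulI[OF schroedinger_group_rep schroedinger_central_character]
      unfolding has_central_character_iff by blast
  \<comment> \<open>Uniqueness composes an isomorphism from \<open>V\<close> to the Schroedinger
    space with one from there to \<open>W\<close>.\<close>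
  qed (use \<pi> in \<open>auto intro: indecomposable_isomorphic_schroedinger
      rep_isomorphic_trans[OF indecomposable_isomorphic_schroedinger(2)
        indecomposable_isomorphic_schroedinger(1)]\<close>)
qed

end
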